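(* Let $F$ be a field and let $L=\{\alpha_1,\dotsc,\alpha_k\}\subset F$ be a set of $k\ge 1$ distinct elements with $0\notin L$. Then the following three statements are equivalent: (a) $N(r-1,L)\geq r+1$ for some natural number $r\ge 1$; (b) there exists a homogeneous polynomial $P\in\mathbb{Z}[x_1,\dotsc,x_k]$ satisfying $P(1,\dotsc,1)=1$ and $P(\alpha_1,\dotsc,\alpha_k)=0$; (c) there exists a constant $c>1$, depending on $L$, such that $N(r,L)\geq cr$ for all sufficiently large $r$. Furthermore, the limit $\lim_{r\to\infty} N(r,L)/r$ always exists (but might be infinite).
   Context: For a subset $L$ of a field $F$, an $L$-matrix is a square matrix over $F$ whose diagonal entries are all $0$ and each of whose off-diagonal entries belongs to $L$. $N(r,L)$ is the maximum $n$ such that there exists an $n\times n$ $L$-matrix of rank at most $r$. In (b), $P(1,\dotsc,1)=1$ is an equality of integers, while $P(\alpha_1,\dotsc,\alpha_k)=0$ is an equality in $F$ (integers are mapped to $F$ via $\mathbb{Z}\to F$). *)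

theory Defs
  imports
    "HOL-Analysis.Analysis"
    "HOL-Library.Poly_Mapping"
    "Jordan_Normal_Form.DL_Rank"
begin

definition L_matrix :: "'a::field set \<Rightarrow> nat \<Rightarrow> 'a mat \<Rightarrow> bool" where
  "L_matrix L n A \<longleftrightarrow> A \<in> carrier_mat n n \<and>
     (\<forall>i<n. A $$ (i, i) = 0) \<and>
     (\<forall>i<n. \<forall>j<n. i \<noteq> j \<longrightarrow> A $$ (i, j) \<in> L)"

definition L_sizes :: "nat \<Rightarrow> 'a::field set \<Rightarrow> nat set" where
  "L_sizes r L = {n. \<exists>A. L_matrix L n A \<and> vec_space.rank n A \<le> r}"

definition N :: "nat \<Rightarrow> 'a::field set \<Rightarrow> nat" where
  "N r L = Max (L_sizes r L)"

text \<open>The maximum is taken over a nonempty set, and over a finite one whenever \<open>L\<close> is finite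
  and does not contain \<open>0\<close>.\<close>

lemma zero_in_L_sizes: "0 \<in> L_sizes r (L :: 'a::field set)"
proof -
  have "vec_space.rank 0 (0\<^sub>m 0 0 :: 'a mat) \<le> 0"
    by (rule vec_space.rank_le_nc) simp
  then show ?thesis
    unfolding L_sizes_def L_matrix_def by (auto intro!: exI[of _ "0\<^sub>m 0 0"])
qed

lemma L_sizes_le:
  fixes L :: "'a::field set"
  assumes Lfin: "finite L" and L0: "0 \<notin> L" and n: "n \<in> L_sizes r L"
  shows "n \<le> (card L + 1) ^ r"
proof -
  interpret vec_space "TYPE('a)" n .
  obtain A where A: "A \<in> carrier_mat n n" and diag: "\<And>i. i < n \<Longrightarrow> A $$ (i, i) = 0"
    and off: "\<And>i j. i < n \<Longrightarrow> j < n \<Longrightarrow> i \<noteq> j \<Longrightarrow> A $$ (i, j) \<in> L"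
    and rk: "rank A \<le> r"
    using n unfolding L_sizes_def L_matrix_def by blast
  have colsc: "set (cols A) \<subseteq> carrier_vec n" using A cols_dim by blast
  have "\<exists>S. finite S \<and> maximal S (\<lambda>T. T \<subseteq> set (cols A) \<and> lin_indpt T) \<and> {} \<subseteq> S"
    by (rule maximal_exists_superset[of "set (cols A)"]) (auto simp: finite_lin_indpt2)
  then obtain S where finS: "finite S"
    and S: "maximal S (\<lambda>T. T \<subseteq> set (cols A) \<and> lin_indpt T)" by blast
  have cS: "card S \<le> r" using rank_card_indpt[OF A S] rk by simp
  have Ssub: "S \<subseteq> set (cols A)" and Sli: "lin_indpt S" using S unfolding maximal_def by auto
  have Sc: "S \<subseteq> carrier_vec n" using Ssub colsc by blast
  have sp: "v \<in> span S" if v: "v \<in> set (cols A)" for v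
  proof (rule ccontr)
    assume nv: "v \<notin> span S"
    have vn: "v \<notin> S" using nv span_mem Sc by blast
    have "lin_indpt (S \<union> {v})"
      using lin_dep_iff_in_span[of S v] Sc Sli v vn nv colsc by auto
    then show False using S v vn Ssub unfolding maximal_def by blast
  qed
  define f where "f i = restrict (\<lambda>s. s $ i) S" for i
  have "inj_on f {..<n}"
  proof (rule inj_onI, rule ccontr)
    fix i i' assume i: "i \<in> {..<n}" and i': "i' \<in> {..<n}" and ff: "f i = f i'" and ne: "i \<noteq> i'"
    have "col A i \<in> set (cols A)" using A i
      by (metis carrier_matD(2) cols_length cols_nth lessThan_iff nth_mem)
    then have "col A i \<in> span S" by (rule sp)
    then obtain a where a: "col A i = lincomb a S" using finite_in_span[OF finS] Sc by (metis)
    have "s $ i = s $ i'" if "s \<in> S" for s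
      using fun_cong[OF ff, of s] that unfolding f_def by simp
    then have "lincomb a S $ i = lincomb a S $ i'"
      using i i' Sc by (simp add: lincomb_index)
    then have "A $$ (i, i) = A $$ (i', i)" using A a[symmetric] i i' by simp
    then show False using diag[of i] off[of i' i] i i' ne L0 by auto
  qed
  moreover have "f ` {..<n} \<subseteq> S \<rightarrow>\<^sub>E insert 0 L"
  proof
    fix g assume "g \<in> f ` {..<n}"
    then obtain i where i: "i < n" and g: "g = f i" by auto
    have "s $ i \<in> insert 0 L" if "s \<in> S" for s
    proof -
      have "s \<in> set (cols A)" using that Ssub by blast
      then obtain j where j: "j < n" and s: "s = col A j"
        using A by (metis carrier_matD(2) cols_length cols_nth in_set_conv_nth)
      show ?thesis using s i j A diag off by (cases "i = j") auto
    qed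
    then show "g \<in> S \<rightarrow>\<^sub>E insert 0 L" unfolding g f_def by auto
  qed
  ultimately have "card {..<n} \<le> card (S \<rightarrow>\<^sub>E insert 0 L)"
    by (rule card_inj_on_le) (simp add: finS Lfin finite_PiE)
  also have "\<dots> = (card L + 1) ^ card S"
    using Lfin L0 by (simp add: card_PiE finS)
  also have "\<dots> \<le> (card L + 1) ^ r"
    using cS by (intro power_increasing) auto
  finally show ?thesis by simp
qed

lemma finite_L_sizes:
  assumes "finite L" and "0 \<notin> L"
  shows "finite (L_sizes r L)"
  using L_sizes_le[OF assms] finite_nat_set_iff_bounded_le by blast

text \<open>An integer polynomial maps each monomial (an exponent function of finite support) to its
  coefficient; only finitely many coefficients are nonzero.\<close>

type_synonym int_mpoly = "(nat \<Rightarrow>\<^sub>0 nat) \<Rightarrow>\<^sub>0 int"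

definition in_variables :: "nat set \<Rightarrow> int_mpoly \<Rightarrow> bool" where
  "in_variables X P \<longleftrightarrow> (\<forall>m \<in> Poly_Mapping.keys P. Poly_Mapping.keys m \<subseteq> X)"

definition homogeneous :: "int_mpoly \<Rightarrow> bool" where
  "homogeneous P \<longleftrightarrow>
     (\<exists>d. \<forall>m \<in> Poly_Mapping.keys P.
       (\<Sum>i \<in> Poly_Mapping.keys m. Poly_Mapping.lookup m i) = d)"

definition eval_mpoly :: "int_mpoly \<Rightarrow> (nat \<Rightarrow> 'a::comm_ring_1) \<Rightarrow> 'a" where
  "eval_mpoly P x = (\<Sum>m \<in> Poly_Mapping.keys P.
     of_int (Poly_Mapping.lookup P m) *
     (\<Prod>i \<in> Poly_Mapping.keys m. x i ^ Poly_Mapping.lookup m i))"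

end

(* Block gluing. If b and c are L-valued (b with zero diagonal) and (b - c) x = 0 for some x \<noteq> 0, then the
   block matrix with four copies of b on the diagonal and c elsewhere kills every vector with blocks
   y_s x, \<Sum> y_s = 0, so it has corank at least 3.

   (b) \<Longrightarrow> corank 3: normalise \<alpha>_1 = 1 and put T = {\<alpha>_i - 1}. Then (b) says that 1 is an integer
   combination of nonempty products over T; writing factors t as t * 1 and expanding that 1, only products of length
   at least 2 remain. Reading each product as a closed walk through one fixed vertex, with fresh inner vertices,
   gives a loopless weighted digraph W with weights in T \<union> -T \<union> {0} and a vector x with W x = x. As
   T \<union> -T \<union> {0} consists of differences of elements of L, W - 1 has the form b - c above.

   Corank 3 \<Longrightarrow> (c): gluing two L-matrices diagonally, with \<alpha>_1 in the off-diagonal blocks, gives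
   N (r + s + 2) \<ge> N r + N s. By Fekete's argument N r / r tends to the supremum of N r / (r + 2), which
   exceeds 1 as soon as N q \<ge> q + 3 for some q.

   (a) \<Longrightarrow> (b): the determinants of L-matrices of sizes r + 1 and r and rank at most r - 1 vanish. As
   polynomials in the entries they are homogeneous, and at (1,...,1) they take the values (-1)^r r and
   (-1)^(r-1) (r - 1). Multiply the second one by a variable and add. *)

theory Submission
  imports Defs "HOL-Computational_Algebra.Group_Closure" "HOL-Real_Asymp.Real_Asymp"
begin

section \<open>Rank as the length of a sum of products\<close>

text \<open>Each summand contributes a matrix of rank at most 1, and rank is subadditive. Together
  with the converse below, this trades \<open>vec_space.rank\<close> for explicit
  factorizations.\<close>

lemma rank_le_of_sum_of_products:
  fixes f :: "nat \<Rightarrow> nat \<Rightarrow> 'a::field"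
  assumes "\<And>i j. i < n \<Longrightarrow> j < m \<Longrightarrow> f i j = (\<Sum>l<r. B i l * C l j)"
  shows "vec_space.rank n (mat n m (\<lambda>(i, j). f i j)) \<le> r"
  using assms
proof (induction r arbitrary: f)
  case 0
  then have "mat n m (\<lambda>(i, j). f i j) = 0\<^sub>m n m"
    by (intro eq_matI) auto
  then show ?case by (simp add: vec_space.rank_0I)
next
  case (Suc r)
  let ?g = "\<lambda>i j. \<Sum>l<r. B i l * C l j"
  let ?M = "mat n m (\<lambda>(i, j). ?g i j)" and ?R = "mat n m (\<lambda>(i, j). B i r * C r j)"
  have eq: "mat n m (\<lambda>(i, j). f i j) = ?M + ?R"
    using Suc.prems by (intro eq_matI) auto
  have "vec_space.rank n (?M + ?R) \<le> vec_space.rank n ?M + vec_space.rank n ?R"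
    by (rule vec_space.rank_subadditive) auto
  moreover have "vec_space.rank n ?M \<le> r"
    by (rule Suc.IH) auto
  moreover have "vec_space.rank n ?R \<le> 1"
    by (rule vec_space.rank_le_1_product_entries) auto
  ultimately have "vec_space.rank n (?M + ?R) \<le> Suc r" by linarith
  with eq show ?case by simp
qed

text \<open>A maximal independent set of columns has at most \<open>r\<close> members and spans all
  columns: \<open>B\<close> lists its members and \<open>C\<close> the coefficients.\<close>

lemma sum_of_products_of_rank:
  fixes A :: "'a::field mat"
  assumes A: "A \<in> carrier_mat n m" and rk: "vec_space.rank n A \<le> r"
  obtains B C where "\<And>i j. i < n \<Longrightarrow> j < m \<Longrightarrow> A $$ (i, j) = (\<Sum>l<r. B i l * C l j)"
proof -
  interpret vec_space "TYPE('a)" n .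
  have colsc: "set (cols A) \<subseteq> carrier_vec n" using A cols_dim by blast
  have "\<exists>S. finite S \<and> maximal S (\<lambda>T. T \<subseteq> set (cols A) \<and> lin_indpt T) \<and> {} \<subseteq> S"
    by (rule maximal_exists_superset[of "set (cols A)"]) (auto simp: finite_lin_indpt2)
  then obtain S where finS: "finite S"
    and S: "maximal S (\<lambda>T. T \<subseteq> set (cols A) \<and> lin_indpt T)" by blast
  have cS: "card S \<le> r" using rank_card_indpt[OF A S] rk by simp
  have Ssub: "S \<subseteq> set (cols A)" and Sli: "lin_indpt S" using S unfolding maximal_def by auto
  have Sc: "S \<subseteq> carrier_vec n" using Ssub colsc by blast
  have sp: "v \<in> span S" if v: "v \<in> set (cols A)" for v
  proof (rule ccontr)
    assume nv: "v \<notin> span S"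
    have vn: "v \<notin> S" using nv span_mem Sc by blast
    have "lin_indpt (S \<union> {v})"
      using lin_dep_iff_in_span[of S v] Sc Sli v vn nv colsc by auto
    then show False using S v vn Ssub unfolding maximal_def by blast
  qed
  have "\<exists>a. col A j = lincomb a S" if "j < m" for j
  proof -
    have "col A j \<in> set (cols A)" using A that
      by (metis carrier_matD(2) cols_length cols_nth nth_mem)
    then show ?thesis using finite_in_span[OF finS] Sc sp by metis
  qed
  then obtain a where a: "\<And>j. j < m \<Longrightarrow> col A j = lincomb (a j) S" by metis
  obtain e where e: "bij_betw e {..<card S} S"
    using bij_betw_from_nat_into_finite finS by blast
  show thesis
  proof
    fix i j assume i: "i < n" and j: "j < m"
    have "A $$ (i, j) = lincomb (a j) S $ i" using A i j a[OF j, symmetric] by simp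
    also have "\<dots> = (\<Sum>s\<in>S. a j s * s $ i)" using i Sc by (rule lincomb_index)
    also have "\<dots> = (\<Sum>l<card S. e l $ i * a j (e l))"
      using sum.reindex_bij_betw[OF e, of "\<lambda>s. a j s * s $ i"] by (simp add: mult.commute)
    \<comment> \<open>The spanning set can have fewer than \<open>r\<close> members, so its list is
      padded with zero columns.\<close>
    also have "\<dots> = (\<Sum>l<r. (if l < card S then e l $ i else 0) * a j (e l))"
      using cS by (intro sum.mono_neutral_cong_left) auto
    finally show "A $$ (i, j) = (\<Sum>l<r. (if l < card S then e l $ i else 0) * a j (e l))" .
  qed
qed

text \<open>Arbitrary finite index sets \<open>V\<close> and \<open>I\<close> let the block
  constructions work over sum and product types without numbering the elements.\<close>

lemma L_sizesI:
  fixes f :: "'b \<Rightarrow> 'b \<Rightarrow> 'a::field" and B :: "'b \<Rightarrow> 'c \<Rightarrow> 'a"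
  assumes "finite V" "finite I" "card I \<le> r"
    and diag: "\<And>u. u \<in> V \<Longrightarrow> f u u = 0"
    and off: "\<And>u v. u \<in> V \<Longrightarrow> v \<in> V \<Longrightarrow> u \<noteq> v \<Longrightarrow> f u v \<in> L"
    and f: "\<And>u v. u \<in> V \<Longrightarrow> v \<in> V \<Longrightarrow> f u v = (\<Sum>l\<in>I. B u l * C l v)"
  shows "card V \<in> L_sizes r L"
proof -
  obtain d where d: "bij_betw d {..<card V} V"
    using bij_betw_from_nat_into_finite \<open>finite V\<close> by blast
  obtain e where e: "bij_betw e {..<card I} I"
    using bij_betw_from_nat_into_finite \<open>finite I\<close> by blast
  let ?A = "mat (card V) (card V) (\<lambda>(i, j). f (d i) (d j))"
  have dV: "d i \<in> V" if "i < card V" for i using d that by (auto simp: bij_betw_def)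
  have dinj: "d i \<noteq> d j" if "i < card V" "j < card V" "i \<noteq> j" for i j
    using d that by (auto simp: bij_betw_def inj_on_def)
  have "vec_space.rank (card V) ?A \<le> card I"
  proof (rule rank_le_of_sum_of_products)
    fix i j assume "i < card V" "j < card V"
    then have "f (d i) (d j) = (\<Sum>l\<in>I. B (d i) l * C l (d j))" by (simp add: dV f)
    also have "\<dots> = (\<Sum>l<card I. B (d i) (e l) * C (e l) (d j))"
      using sum.reindex_bij_betw[OF e, of "\<lambda>l. B (d i) l * C l (d j)"] by simp
    finally show "f (d i) (d j) = (\<Sum>l<card I. B (d i) (e l) * C (e l) (d j))" .
  qed
  moreover have "L_matrix L (card V) ?A"
    unfolding L_matrix_def by (auto simp: dV dinj diag off)
  ultimately show ?thesis
    using \<open>card I \<le> r\<close> unfolding L_sizes_def by (auto intro: order_trans)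
qed

lemma L_sizesD:
  fixes L :: "'a::field set"
  assumes "n \<in> L_sizes r L"
  shows "\<exists>f B C. (\<forall>i<n. f i i = 0) \<and> (\<forall>i<n. \<forall>j<n. i \<noteq> j \<longrightarrow> f i j \<in> L) \<and>
    (\<forall>i<n. \<forall>j<n. f i j = (\<Sum>l<r. B i l * C l j :: 'a))"
proof -
  obtain A where A: "A \<in> carrier_mat n n" and diag: "\<forall>i<n. A $$ (i, i) = 0"
    and off: "\<forall>i<n. \<forall>j<n. i \<noteq> j \<longrightarrow> A $$ (i, j) \<in> L"
    and rk: "vec_space.rank n A \<le> r"
    using assms unfolding L_sizes_def L_matrix_def by blast
  obtain B C where "\<And>i j. i < n \<Longrightarrow> j < n \<Longrightarrow> A $$ (i, j) = (\<Sum>l<r. B i l * C l j)"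
    by (rule sum_of_products_of_rank[OF A rk]) blast
  with diag off show ?thesis
    by (intro exI[of _ "\<lambda>i j. A $$ (i, j)"] exI[of _ B] exI[of _ C]) simp
qed

text \<open>A factorization restricts to the first \<open>m\<close> rows and columns.\<close>

lemma L_sizes_downward:
  assumes "n \<in> L_sizes r L" and "m \<le> n"
  shows "m \<in> L_sizes r (L :: 'a::field set)"
proof -
  obtain f B C where f0: "\<forall>i<n. f i i = 0"
    "\<forall>i<n. \<forall>j<n. i \<noteq> j \<longrightarrow> f i j \<in> L"
    "\<forall>i<n. \<forall>j<n. f i j = (\<Sum>l<r. B i l * C l j :: 'a)"
    using L_sizesD[OF assms(1)] by (elim exE conjE) (rule that)
  have "card {..<m} \<in> L_sizes r L"
    by (rule L_sizesI[of _ "{..<r}" _ f _ B C]) (use f0 \<open>m \<le> n\<close> in auto)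
  then show ?thesis by simp
qed

lemma L_sizes_mono:
  assumes "n \<in> L_sizes r L" and "r \<le> s"
  shows "n \<in> L_sizes s L"
  using assms unfolding L_sizes_def by auto

text \<open>The two given matrices become diagonal blocks. Each of the two constant off-diagonal
  blocks has rank at most 1, whence the extra 2.\<close>

lemma L_sizes_add:
  fixes L :: "'a::field set"
  assumes "n \<in> L_sizes r L" and "m \<in> L_sizes s L" and "\<alpha> \<in> L"
  shows "n + m \<in> L_sizes (r + s + 2) L"
proof -
  obtain f B C where f: "\<forall>i<n. f i i = 0"
    "\<forall>i<n. \<forall>j<n. i \<noteq> j \<longrightarrow> f i j \<in> L"
    "\<forall>i<n. \<forall>j<n. f i j = (\<Sum>l<r. B i l * C l j :: 'a)"
    using L_sizesD[OF assms(1)] by (elim exE conjE) (rule that)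
  obtain g D E where g: "\<forall>i<m. g i i = 0"
    "\<forall>i<m. \<forall>j<m. i \<noteq> j \<longrightarrow> g i j \<in> L"
    "\<forall>i<m. \<forall>j<m. g i j = (\<Sum>l<s. D i l * E l j :: 'a)"
    using L_sizesD[OF assms(2)] by (elim exE conjE) (rule that)
  define h :: "nat + nat \<Rightarrow> nat + nat \<Rightarrow> 'a" where
    "h u v = (case u of Inl i \<Rightarrow> (case v of Inl j \<Rightarrow> f i j | Inr j \<Rightarrow> \<alpha>)
                      | Inr i \<Rightarrow> (case v of Inl j \<Rightarrow> \<alpha> | Inr j \<Rightarrow> g i j))" for u v
  \<comment> \<open>The inner indices in \<open>Inl\<close> factor the diagonal blocks;
    \<open>Inr b\<close> produces the constant block whose rows satisfy \<open>isl u = b\<close> and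
    whose columns do not.\<close>
  define X :: "nat + nat \<Rightarrow> (nat + nat) + bool \<Rightarrow> 'a" where
    "X u l = (case l of Inl (Inl l) \<Rightarrow> (case u of Inl i \<Rightarrow> B i l | Inr _ \<Rightarrow> 0)
                      | Inl (Inr l) \<Rightarrow> (case u of Inl i \<Rightarrow> 0 | Inr i \<Rightarrow> D i l)
                      | Inr b \<Rightarrow> (if b = isl u then \<alpha> else 0))" for u l
  define Y :: "(nat + nat) + bool \<Rightarrow> nat + nat \<Rightarrow> 'a" where
    "Y l u = (case l of Inl (Inl l) \<Rightarrow> (case u of Inl i \<Rightarrow> C l i | Inr _ \<Rightarrow> 0)
                      | Inl (Inr l) \<Rightarrow> (case u of Inl i \<Rightarrow> 0 | Inr i \<Rightarrow> E l i)
                      | Inr b \<Rightarrow> (if b = isl u then 0 else 1))" for u l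
  have "card ({..<n} <+> {..<m}) \<in> L_sizes (r + s + 2) L"
  proof (rule L_sizesI[of _ "({..<r} <+> {..<s}) <+> UNIV" _ h _ X Y])
    show "h u u = 0" if "u \<in> {..<n} <+> {..<m}" for u
      using f(1) g(1) that by (auto simp: h_def)
    show "h u v \<in> L" if "u \<in> {..<n} <+> {..<m}" "v \<in> {..<n} <+> {..<m}" "u \<noteq> v" for u v
      using f(2) g(2) \<open>\<alpha> \<in> L\<close> that by (auto simp: h_def) blast+
    show "h u v = (\<Sum>l\<in>({..<r} <+> {..<s}) <+> UNIV. X u l * Y l v)"
      if "u \<in> {..<n} <+> {..<m}" "v \<in> {..<n} <+> {..<m}" for u v
      using that f(3) g(3) by (elim PlusE)
        (simp_all add: h_def X_def Y_def sum.Plus UNIV_bool)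
  qed (simp_all add: card_Plus)
  then show ?thesis by (simp add: card_Plus)
qed

section \<open>Kernel vectors and block gluing\<close>

text \<open>The vectors \<open>z q\<close> are independent elements of the kernel, echelonised at the positions
  \<open>D\<close>, so the columns of \<open>f\<close> at these positions are combinations of the other columns.\<close>

lemma L_sizes_of_kernel:
  fixes f :: "'b \<Rightarrow> 'b \<Rightarrow> 'a::field"
  assumes "finite V" "D \<subseteq> V"
    and diag: "\<And>u. u \<in> V \<Longrightarrow> f u u = 0"
    and off: "\<And>u v. u \<in> V \<Longrightarrow> v \<in> V \<Longrightarrow> u \<noteq> v \<Longrightarrow> f u v \<in> L"
    and ker: "\<And>u q. u \<in> V \<Longrightarrow> q \<in> D \<Longrightarrow> (\<Sum>v\<in>V. f u v * z q v) = 0"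
    and z: "\<And>p q. p \<in> D \<Longrightarrow> q \<in> D \<Longrightarrow> z q p = (if p = q then 1 else 0)"
  shows "card V \<in> L_sizes (card V - card D) L"
proof (rule L_sizesI[of _ "V - D" _ f])
  have finD: "finite D" using assms(1,2) finite_subset by blast
  show "card (V - D) \<le> card V - card D" using finD \<open>D \<subseteq> V\<close> by (simp add: card_Diff_subset)
  fix u v assume u: "u \<in> V" and v: "v \<in> V"
  show "f u v = (\<Sum>l\<in>V - D. f u l * (if v \<in> D then - z v l else if l = v then 1 else 0))"
  proof (cases "v \<in> D")
    case True
    have "0 = (\<Sum>l\<in>V - D. f u l * z v l) + (\<Sum>l\<in>D. f u l * z v l)"
      using ker[OF u True] sum.subset_diff[OF \<open>D \<subseteq> V\<close> \<open>finite V\<close>, of "\<lambda>l. f u l * z v l"] by simp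
    also have "(\<Sum>l\<in>D. f u l * z v l) = f u v"
      using finD True by (simp add: z if_distrib cong: if_cong)
    finally have "f u v = - (\<Sum>l\<in>V - D. f u l * z v l)"
      by (metis add.commute eq_neg_iff_add_eq_0)
    with True show ?thesis by (simp add: sum_negf)
  next
    case False
    then show ?thesis using v \<open>finite V\<close> by (simp add: if_distrib cong: if_cong)
  qed
qed (use assms in auto)

text \<open>With I and J the identity and the all-ones matrix of size 4, the glued matrix is (b - c)
  \<otimes> I + c \<otimes> J. Both terms kill x \<otimes> y when the coordinates of y add up to 0,
  and such y form a space of dimension 3. The normalisation \<open>x v0 = 1\<close> echelonises
  these vectors at the positions \<open>?D\<close>.\<close>

lemma L_sizes_of_difference:
  fixes b c :: "'b \<Rightarrow> 'b \<Rightarrow> 'a::field"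
  assumes "finite V" "v0 \<in> V" "x v0 = 1"
    and diag: "\<And>u. u \<in> V \<Longrightarrow> b u u = 0"
    and b: "\<And>u v. u \<in> V \<Longrightarrow> v \<in> V \<Longrightarrow> u \<noteq> v \<Longrightarrow> b u v \<in> L"
    and c: "\<And>u v. u \<in> V \<Longrightarrow> v \<in> V \<Longrightarrow> c u v \<in> L"
    and x: "\<And>u. u \<in> V \<Longrightarrow> (\<Sum>v\<in>V. (b u v - c u v) * x v) = 0"
  shows "4 * card V \<in> L_sizes (4 * card V - 3) L"
proof -
  let ?V = "V \<times> {..<4::nat}" and ?D = "{v0} \<times> {..<3::nat}"
  define f where "f = (\<lambda>(u, s :: nat) (v, t). if s = t then b u v else c u v)"
  \<comment> \<open>For \<open>q < 3\<close> this is the difference of the unit vectors with index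
    \<open>q\<close> and 3; hence the coordinate 3 is left out of \<open>?D\<close>.\<close>
  define y :: "nat \<Rightarrow> nat \<Rightarrow> 'a" where "y q t = (if t = q then 1 else if t = 3 then -1 else 0)" for q t
  define z where "z = (\<lambda>(w :: 'b, q) (v, t). x v * y q t)"
  have "card ?V \<in> L_sizes (card ?V - card ?D) L"
  proof (rule L_sizes_of_kernel[of _ _ f _ z])
    show "(\<Sum>v\<in>?V. f p v * z q v) = 0" if "p \<in> ?V" and q: "q \<in> ?D" for p q
    proof -
      from that obtain u s where p: "p = (u, s)" "u \<in> V" "s < 4" by auto
      have q3: "snd q < 3" using q by auto
      have 4: "{..<4::nat} = {0, 1, 2, 3}" by auto
      have y0: "(\<Sum>t<4. y (snd q) t) = 0" using q3 unfolding 4 y_def by auto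
      have "(\<Sum>v\<in>?V. f p v * z q v)
          = (\<Sum>v\<in>V. \<Sum>t<4. f (u, s) (v, t) * (x v * y (snd q) t))"
        by (simp add: sum.cartesian_product p z_def case_prod_beta)
      also have "\<dots> = (\<Sum>v\<in>V. (b u v - c u v) * x v * y (snd q) s + c u v * x v * (\<Sum>t<4. y (snd q) t))"
      proof (rule sum.cong[OF refl])
        fix v
        have "(\<Sum>t<4. f (u, s) (v, t) * (x v * y (snd q) t))
            = (\<Sum>t<4. (if s = t then (b u v - c u v) * x v * y (snd q) s else 0)
                + c u v * x v * y (snd q) t)"
          by (rule sum.cong[OF refl]) (auto simp: f_def algebra_simps)
        also have "\<dots> = (b u v - c u v) * x v * y (snd q) s + c u v * x v * (\<Sum>t<4. y (snd q) t)"
          using p(3) by (simp add: sum.distrib sum_distrib_left)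
        finally show "(\<Sum>t<4. f (u, s) (v, t) * (x v * y (snd q) t)) = \<dots>" .
      qed
      also have "\<dots> = (\<Sum>v\<in>V. (b u v - c u v) * x v) * y (snd q) s"
        unfolding y0 by (simp add: sum_distrib_right)
      also have "\<dots> = 0" using x p by simp
      finally show ?thesis .
    qed
    show "f p q \<in> L" if "p \<in> ?V" "q \<in> ?V" "p \<noteq> q" for p q
      using that b c by (cases p; cases q) (auto simp: f_def)
  qed (use assms in \<open>auto simp: f_def z_def y_def split: if_splits\<close>)
  then show ?thesis by (simp add: card_cartesian_product mult.commute)
qed

section \<open>Closed walks and fixed vectors\<close>

text \<open>A list entry \<open>(x, c)\<close> is an inner vertex with value \<open>x\<close> and an edge of weight \<open>c\<close> from the
  base vertex to it; its own outgoing edge, of weight \<open>t\<close>, ends at the base vertex (of value \<open>1\<close>)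
  or at another entry.\<close>

definition link :: "'a::comm_ring_1 set \<Rightarrow> ('a \<times> 'a) list \<Rightarrow> nat \<Rightarrow> bool" where
  "link T ps u \<longleftrightarrow> snd (ps ! u) \<in> insert 0 (T \<union> uminus ` T) \<and>
     (\<exists>t\<in>T. fst (ps ! u) = t \<or> (\<exists>v<length ps. v \<noteq> u \<and> fst (ps ! u) = t * fst (ps ! v)))"

definition chain :: "'a::comm_ring_1 set \<Rightarrow> ('a \<times> 'a) list \<Rightarrow> bool" where
  "chain T ps \<longleftrightarrow> (\<forall>u<length ps. link T ps u)"

text \<open>The sum is what the weighted adjacency matrix yields at the base vertex when applied to
  the vector of values. Hence \<open>1 \<in> chain_sums T\<close> supplies the fixed-vector equation
  at the base vertex, while \<open>chain\<close> supplies those at the inner vertices.\<close>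

definition chain_sums :: "'a::comm_ring_1 set \<Rightarrow> 'a set" where
  "chain_sums T = {\<Sum>(x, c)\<leftarrow>ps. c * x | ps. chain T ps}"

lemma link_append1:
  assumes "link T ps u" and "u < length ps"
  shows "link T (ps @ qs) u"
proof -
  obtain t where t: "t \<in> T" "fst (ps ! u) = t \<or>
      (\<exists>v<length ps. v \<noteq> u \<and> fst (ps ! u) = t * fst (ps ! v))"
    using assms(1) unfolding link_def by blast
  from t(2) have "fst (ps ! u) = t \<or>
      (\<exists>v<length (ps @ qs). v \<noteq> u \<and> fst (ps ! u) = t * fst ((ps @ qs) ! v))"
  proof
    assume "\<exists>v<length ps. v \<noteq> u \<and> fst (ps ! u) = t * fst (ps ! v)"
    then obtain v where "v < length ps" "v \<noteq> u" "fst (ps ! u) = t * fst (ps ! v)" by blast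
    then show ?thesis by (intro disjI2 exI[of _ v]) (simp add: nth_append)
  qed simp
  moreover have "(ps @ qs) ! u = ps ! u" using assms(2) by (simp add: nth_append)
  ultimately show ?thesis using t(1) assms(1) unfolding link_def by metis
qed

lemma link_append2:
  assumes "link T qs u"
  shows "link T (ps @ qs) (length ps + u)"
proof -
  obtain t where t: "t \<in> T" "fst (qs ! u) = t \<or>
      (\<exists>v<length qs. v \<noteq> u \<and> fst (qs ! u) = t * fst (qs ! v))"
    using assms(1) unfolding link_def by blast
  from t(2) have "fst (qs ! u) = t \<or>
      (\<exists>v<length (ps @ qs). v \<noteq> length ps + u \<and> fst (qs ! u) = t * fst ((ps @ qs) ! v))"
  proof
    assume "\<exists>v<length qs. v \<noteq> u \<and> fst (qs ! u) = t * fst (qs ! v)"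
    then obtain v where "v < length qs" "v \<noteq> u" "fst (qs ! u) = t * fst (qs ! v)" by blast
    then show ?thesis by (intro disjI2 exI[of _ "length ps + v"]) simp
  qed simp
  moreover have "(ps @ qs) ! (length ps + u) = qs ! u" by simp
  ultimately show ?thesis using t(1) assms unfolding link_def by metis
qed

lemma chain_append:
  assumes "chain T ps" and "chain T qs"
  shows "chain T (ps @ qs)"
  unfolding chain_def
proof (intro allI impI)
  fix u assume u: "u < length (ps @ qs)"
  show "link T (ps @ qs) u"
  proof (cases "u < length ps")
    case True
    with assms(1) show ?thesis by (simp add: chain_def link_append1)
  next
    case False
    then show ?thesis
      using assms(2) u link_append2[of T qs "u - length ps" ps] by (simp add: chain_def)
  qed
qed

text \<open>Links between entries involve the values only, so the edges out of the base vertex can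
  be reweighted freely. This serves to negate them and to switch one on.\<close>

lemma chain_change_coefficients:
  assumes "chain T ps" and eq: "map fst qs = map fst ps"
    and "\<And>c. c \<in> snd ` set qs \<Longrightarrow> c \<in> insert 0 (T \<union> uminus ` T)"
  shows "chain T qs"
proof -
  have len: "length qs = length ps" using eq by (metis length_map)
  have fst: "fst (qs ! v) = fst (ps ! v)" if "v < length ps" for v
    using that eq len by (metis nth_map)
  have "snd (qs ! u) \<in> insert 0 (T \<union> uminus ` T)" if "u < length ps" for u
    using that assms(3) len by (metis image_eqI nth_mem)
  with assms(1) show ?thesis
    unfolding chain_def link_def len by (metis fst)
qed

lemma zero_in_chain_sums: "0 \<in> chain_sums T"
  unfolding chain_sums_def chain_def link_def by (rule CollectI, rule exI[of _ "[]"]) simp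

lemma chain_sums_diff:
  assumes "a \<in> chain_sums T" and "b \<in> chain_sums T"
  shows "a - b \<in> chain_sums T"
proof -
  obtain ps qs where ps: "chain T ps" "a = (\<Sum>(x, c)\<leftarrow>ps. c * x)"
    and qs: "chain T qs" "b = (\<Sum>(x, c)\<leftarrow>qs. c * x)"
    using assms unfolding chain_sums_def by blast
  let ?qs = "map (\<lambda>(x, c). (x, - c)) qs"
  have "chain T ?qs"
  proof (rule chain_change_coefficients[OF qs(1)])
    have "c \<in> insert 0 (T \<union> uminus ` T)" if "(x, c) \<in> set qs" for x c
      using that qs(1) unfolding chain_def link_def by (metis in_set_conv_nth snd_conv)
    then show "c \<in> insert 0 (T \<union> uminus ` T)" if "c \<in> snd ` set ?qs" for c
      using that by fastforce
  qed (simp add: case_prod_beta comp_def)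
  with ps(1) have "chain T (ps @ ?qs)" by (rule chain_append)
  moreover have "(\<Sum>(x, c)\<leftarrow>?qs. c * x) = - b"
    unfolding qs(2) by (induction qs) auto
  then have "a - b = (\<Sum>(x, c)\<leftarrow>ps @ ?qs. c * x)"
    unfolding ps(2) by simp
  ultimately show ?thesis unfolding chain_sums_def by blast
qed

text \<open>A letter put in front of the word becomes a new last entry whose edge leads to the
  former last one. All coefficients are 0, so the path is not yet reached from the base
  vertex.\<close>

lemma prod_list_in_chain:
  assumes "ws \<noteq> []" and "set ws \<subseteq> T"
  shows "\<exists>ps. chain T (ps @ [(prod_list ws, 0)]) \<and> (\<forall>p\<in>set ps. snd p = 0)"
  using assms
proof (induction ws rule: list_nonempty_induct)
  case (single t)
  then show ?case by (intro exI[of _ "[]"]) (auto simp: chain_def link_def)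
next
  case (cons t ws)
  then obtain ps where ps: "chain T (ps @ [(prod_list ws, 0)])" "\<forall>p\<in>set ps. snd p = 0"
    by auto
  let ?qs = "ps @ [(prod_list ws, 0)]"
  have "chain T (?qs @ [(prod_list (t # ws), 0)])"
    unfolding chain_def
  proof (intro allI impI)
    fix u assume u: "u < length (?qs @ [(prod_list (t # ws), 0)])"
    show "link T (?qs @ [(prod_list (t # ws), 0)]) u"
    proof (cases "u < length ?qs")
      case True
      with ps(1) show ?thesis unfolding chain_def by (blast intro: link_append1)
    next
      case False
      then have "u = length ?qs" using u by simp
      then show ?thesis
        using cons.prems unfolding link_def
        by (intro conjI bexI[of _ t] disjI2 exI[of _ "length ps"]) (auto simp: nth_append)
    qed
  qed
  then show ?case using ps(2) by (intro exI[of _ ?qs]) auto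
qed

text \<open>An edge of weight \<open>t\<close> from the base vertex to the last entry closes the
  walk. As \<open>ws\<close> is nonempty, the walk has an inner vertex and no loop arises at the
  base vertex.\<close>

lemma mult_prod_list_in_chain_sums:
  assumes "ws \<noteq> []" and "set ws \<subseteq> T" and "t \<in> T"
  shows "t * prod_list ws \<in> chain_sums T"
proof -
  obtain ps where ps: "chain T (ps @ [(prod_list ws, 0)])" "\<forall>p\<in>set ps. snd p = 0"
    using prod_list_in_chain[OF assms(1,2)] by blast
  have "chain T (ps @ [(prod_list ws, t)])"
    by (rule chain_change_coefficients[OF ps(1)]) (use ps(2) \<open>t \<in> T\<close> in auto)
  moreover have "(\<Sum>(x, c)\<leftarrow>ps. c * x) = 0"
    using ps(2) by (induction ps) auto
  ultimately show ?thesis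
    unfolding chain_sums_def by (auto intro!: exI[of _ "ps @ [(prod_list ws, t)]"])
qed

text \<open>Prefixing a letter \<open>t\<close> makes every word have length at least 2, so
  \<open>mult\<close> covers all of t * \<open>?G\<close>. One-letter words then come from t = t *
  1, with 1 in \<open>?G\<close> by hypothesis.\<close>

lemma one_in_chain_sums:
  fixes T :: "'a::comm_ring_1 set"
  assumes "1 \<in> group_closure {prod_list ws | ws. ws \<noteq> [] \<and> set ws \<subseteq> T}"
  shows "1 \<in> chain_sums T"
proof -
  let ?G = "group_closure {prod_list ws | ws. ws \<noteq> [] \<and> set ws \<subseteq> T}"
  have mult: "t * y \<in> chain_sums T" if "y \<in> ?G" "t \<in> T" for y t
    using that(1)
  proof induction
    case (base y)
    then show ?case
      using zero_in_chain_sums mult_prod_list_in_chain_sums \<open>t \<in> T\<close> by auto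
  next
    case (diff y y')
    then show ?case by (simp add: chain_sums_diff right_diff_distrib)
  qed
  have "y \<in> chain_sums T" if "y \<in> ?G" for y
    using that
  proof induction
    case (base y)
    then consider "y = 0" | ws where "ws \<noteq> []" "set ws \<subseteq> T" "y = prod_list ws" by auto
    then show ?case
    proof cases
      case 1
      then show ?thesis by (simp add: zero_in_chain_sums)
    next
      case 2
      then obtain t vs where ws: "ws = t # vs" "t \<in> T" "set vs \<subseteq> T"
        by (cases ws) auto
      show ?thesis
      proof (cases "vs = []")
        case True
        then show ?thesis using mult[OF assms ws(2)] 2 ws by simp
      next
        case False
        then show ?thesis using mult_prod_list_in_chain_sums[OF False ws(3,2)] 2 ws by simp
      qed
    qed
  next
    case (diff y y')
    then show ?case by (simp add: chain_sums_diff)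
  qed
  with assms show ?thesis by blast
qed

text \<open>Vertex \<open>0\<close> of the digraph carries the value \<open>1\<close>, vertex \<open>Suc u\<close> the \<open>u\<close>-th value of the
  chain; \<open>W\<close> is the weighted adjacency matrix, and \<open>W x = x\<close>.\<close>

lemma chain_sums_fixed_vector:
  assumes "1 \<in> chain_sums T"
  obtains n :: nat and W :: "nat \<Rightarrow> nat \<Rightarrow> 'a::comm_ring_1" and x
  where "x 0 = 1" and "\<And>u. W u u = 0"
    and "\<And>u v. W u v \<in> insert 0 (T \<union> uminus ` T)"
    and "\<And>u. u \<le> n \<Longrightarrow> (\<Sum>v\<le>n. W u v * x v) = x u"
proof -
  obtain ps where ps: "chain T ps" and one: "1 = (\<Sum>(x, c)\<leftarrow>ps. c * x)"
    using assms unfolding chain_sums_def by blast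
  define n where "n = length ps"
  define x where "x u = (case u of 0 \<Rightarrow> 1 | Suc u \<Rightarrow> fst (ps ! u))" for u
  have "\<exists>t w. t \<in> T \<and> w \<le> n \<and> w \<noteq> Suc u \<and> x (Suc u) = t * x w" if "u < n" for u
  proof -
    have "link T ps u" using ps that unfolding chain_def n_def by blast
    then obtain t where "t \<in> T" and t: "fst (ps ! u) = t \<or>
        (\<exists>v<length ps. v \<noteq> u \<and> fst (ps ! u) = t * fst (ps ! v))"
      unfolding link_def by blast
    from t show ?thesis
    proof
      assume "fst (ps ! u) = t"
      then show ?thesis using \<open>t \<in> T\<close> by (intro exI[of _ t] exI[of _ 0]) (simp add: x_def)
    next
      assume "\<exists>v<length ps. v \<noteq> u \<and> fst (ps ! u) = t * fst (ps ! v)"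
      then obtain v where "v < length ps" "v \<noteq> u" "fst (ps ! u) = t * fst (ps ! v)" by blast
      then show ?thesis using \<open>t \<in> T\<close>
        by (intro exI[of _ t] exI[of _ "Suc v"]) (simp add: x_def n_def)
    qed
  qed
  then obtain t w where tw: "\<And>u. u < n \<Longrightarrow> t u \<in> T \<and> w u \<le> n \<and> w u \<noteq> Suc u \<and> x (Suc u) = t u * x (w u)"
    by metis
  \<comment> \<open>Row 0 holds the edges out of the base vertex; any other row holds at most one
    edge, to the vertex \<open>w u\<close>. Entries out of range are 0, so the weight condition
    holds for all indices.\<close>
  define W where "W u v = (case u of
      0 \<Rightarrow> (case v of 0 \<Rightarrow> 0 | Suc v \<Rightarrow> if v < n then snd (ps ! v) else 0)
    | Suc u \<Rightarrow> if u < n \<and> v = w u then t u else 0)" for u v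
  show thesis
  proof
    show "x 0 = 1" by (simp add: x_def)
    show "W u u = 0" for u
    proof (cases u)
      case (Suc u')
      have "u' < n \<Longrightarrow> Suc u' \<noteq> w u'" using tw by metis
      then show ?thesis by (auto simp: W_def Suc)
    qed (simp add: W_def)
    have "snd (ps ! v) \<in> insert 0 (T \<union> uminus ` T)" if "v < n" for v
      using ps that unfolding chain_def link_def n_def by blast
    then show "W u v \<in> insert 0 (T \<union> uminus ` T)" for u v
      using tw by (auto simp: W_def split: nat.splits)
    show "(\<Sum>v\<le>n. W u v * x v) = x u" if u: "u \<le> n" for u
    proof (cases u)
      case 0
      have "(\<Sum>v\<le>n. W 0 v * x v) = (\<Sum>v<n. W 0 (Suc v) * x (Suc v))"
        by (simp add: sum.atMost_shift W_def)
      also have "\<dots> = (\<Sum>v<n. snd (ps ! v) * fst (ps ! v))"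
        by (intro sum.cong) (simp_all add: W_def x_def)
      also have "\<dots> = (\<Sum>(x, c)\<leftarrow>ps. c * x)"
        by (simp add: sum_list_sum_nth n_def case_prod_beta atLeast0LessThan)
      finally show ?thesis using one 0 by (simp add: x_def)
    next
      case (Suc u')
      then have "(\<Sum>v\<le>n. W u v * x v) = (\<Sum>v\<le>n. if v = w u' then t u' * x (w u') else 0)"
        using u by (intro sum.cong) (auto simp: W_def)
      also have "\<dots> = x u" using tw[of u'] u Suc by simp
      finally show ?thesis .
    qed
  qed
qed

section \<open>Values of homogeneous polynomials\<close>

text \<open>The pairs \<open>(P(1,\<dots>,1), P(\<alpha>\<^sub>1,\<dots>,\<alpha>\<^sub>k))\<close> for \<open>P\<close> homogeneous of degree \<open>d\<close>.\<close>

definition homogeneous_values :: "nat \<Rightarrow> 'a::comm_ring_1 set \<Rightarrow> (int \<times> 'a) set" where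
  "homogeneous_values d L = group_closure {(1, prod_list ws) | ws. length ws = d \<and> set ws \<subseteq> L}"

lemma homogeneous_values_induct [consumes 1, case_names zero monomial diff]:
  assumes "p \<in> homogeneous_values d L"
    and "P 0 0"
    and "\<And>ws. length ws = d \<Longrightarrow> set ws \<subseteq> L \<Longrightarrow> P 1 (prod_list ws)"
    and "\<And>a b a' b'. P a b \<Longrightarrow> P a' b' \<Longrightarrow> P (a - a') (b - b')"
  shows "P (fst p) (snd p)"
  using assms(1) unfolding homogeneous_values_def
  by (induction p rule: group_closure.induct) (auto simp: assms(2-))

lemma monomial_in_homogeneous_values:
  "length ws = d \<Longrightarrow> set ws \<subseteq> L \<Longrightarrow> (1, prod_list ws) \<in> homogeneous_values d L"
  unfolding homogeneous_values_def by (rule group_closure.base) auto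

lemma homogeneous_values_zero: "(0, 0) \<in> homogeneous_values d L"
  unfolding homogeneous_values_def zero_prod_def[symmetric] by (rule zero_in_group_closure)

lemma homogeneous_values_diff:
  "(a, b) \<in> homogeneous_values d L \<Longrightarrow> (a', b') \<in> homogeneous_values d L \<Longrightarrow>
    (a - a', b - b') \<in> homogeneous_values d L"
  unfolding homogeneous_values_def using group_closure.diff by fastforce

lemma homogeneous_values_minus:
  "(a, b) \<in> homogeneous_values d L \<Longrightarrow> (- a, - b) \<in> homogeneous_values d L"
  using homogeneous_values_diff[OF homogeneous_values_zero] by fastforce

lemma homogeneous_values_add:
  "(a, b) \<in> homogeneous_values d L \<Longrightarrow> (a', b') \<in> homogeneous_values d L \<Longrightarrow>
    (a + a', b + b') \<in> homogeneous_values d L"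
  using homogeneous_values_diff[of a b d L "- a'" "- b'"] homogeneous_values_minus by fastforce

lemma homogeneous_values_sum:
  "(\<And>i. i \<in> S \<Longrightarrow> (f i, g i) \<in> homogeneous_values d L) \<Longrightarrow>
    (sum f S, sum g S) \<in> homogeneous_values d L"
  by (induction S rule: infinite_finite_induct)
    (auto intro: homogeneous_values_zero homogeneous_values_add)

lemma homogeneous_values_of_nat_mult:
  "(a, b) \<in> homogeneous_values d L \<Longrightarrow> (of_nat n * a, of_nat n * b) \<in> homogeneous_values d L"
  by (induction n) (auto simp: distrib_right intro: homogeneous_values_zero homogeneous_values_add)

lemma homogeneous_values_of_int_mult:
  assumes "(a, b) \<in> homogeneous_values d L"
  shows "(n * a, of_int n * b) \<in> homogeneous_values d L"
proof (cases n rule: int_cases2)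
  case (nonneg m)
  with homogeneous_values_of_nat_mult[OF assms, of m] show ?thesis by simp
next
  case (nonpos m)
  with homogeneous_values_minus[OF homogeneous_values_of_nat_mult[OF assms, of m]]
  show ?thesis by simp
qed

text \<open>Multiplying by a variable of value \<open>x\<close> raises the degree and keeps the
  value at (1,...,1). This brings determinants of consecutive sizes to the same degree.\<close>

lemma homogeneous_values_mult:
  assumes "(a, b) \<in> homogeneous_values d L" and "x \<in> L"
  shows "(a, x * b) \<in> homogeneous_values (Suc d) L"
proof -
  have "(fst p, x * snd p) \<in> homogeneous_values (Suc d) L" if "p \<in> homogeneous_values d L" for p
    using that
  proof (induction rule: homogeneous_values_induct)
    case zero
    then show ?case by (simp add: homogeneous_values_zero)
  next
    case (monomial ws)
    then show ?case
      using monomial_in_homogeneous_values[of "x # ws" "Suc d" L] \<open>x \<in> L\<close> by simp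
  next
    case (diff a b a' b')
    then show ?case by (simp add: right_diff_distrib homogeneous_values_diff)
  qed
  from this[OF assms(1)] show ?thesis by simp
qed

section \<open>Determinants: from (a) to (b)\<close>

text \<open>This is an L-matrix pattern with all variables set to 1, so its determinant is the value
  at (1,...,1) of the determinant polynomial.\<close>

definition offdiag_ones :: "nat \<Rightarrow> int mat" where
  "offdiag_ones n = mat n n (\<lambda>(i, j). if i = j then 0 else 1)"

text \<open>The all-ones vector is an eigenvector for the eigenvalue \<open>m\<close>. Replacing the
  first unit vector by it is the base change \<open>U\<close> of determinant 1, which turns the
  matrix into the triangular \<open>T\<close> with diagonal m, -1, ..., -1.\<close>

lemma det_offdiag_ones: "det (offdiag_ones (Suc m)) = (- 1) ^ m * int m"
proof -
  let ?n = "Suc m"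
  let ?K = "offdiag_ones ?n"
  define U where "U = mat ?n ?n (\<lambda>(i, j). if i = j \<or> j = 0 then 1 else 0 :: int)"
  define T where "T = mat ?n ?n (\<lambda>(i, j). if i = 0 then (if j = 0 then int m else 1)
    else if i = j then - 1 else 0)"
  have c: "?K \<in> carrier_mat ?n ?n" "U \<in> carrier_mat ?n ?n" "T \<in> carrier_mat ?n ?n"
    by (simp_all add: offdiag_ones_def U_def T_def)
  have "det U = prod_list (diag_mat U)"
    by (rule det_lower_triangular[OF _ c(2)]) (auto simp: U_def)
  then have U: "det U = 1" by (simp add: prod_list_diag_prod U_def)
  have "det T = prod_list (diag_mat T)"
    by (rule det_upper_triangular[OF _ c(3)]) (auto simp: T_def upper_triangular_def)
  also have "\<dots> = (\<Prod>i<Suc m. T $$ (i, i))"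
    unfolding prod_list_diag_prod by (simp add: T_def atLeast0LessThan)
  also have "\<dots> = T $$ (0, 0) * (\<Prod>i<m. T $$ (Suc i, Suc i))"
    by (rule prod.lessThan_Suc_shift)
  also have "\<dots> = int m * (\<Prod>i<m. - 1)"
    by (simp add: T_def)
  finally have T: "det T = (- 1) ^ m * int m" by simp
  have "?K * U = U * T"
  proof (rule eq_matI)
    fix i j assume "i < dim_row (U * T)" "j < dim_col (U * T)"
    then have i: "i < ?n" and j: "j < ?n" by (simp_all add: U_def T_def)
    have "(?K * U) $$ (i, j) = (\<Sum>l<?n. (if i = l then 0 else 1) * (if l = j \<or> j = 0 then 1 else 0))"
      using i j by (simp add: offdiag_ones_def U_def scalar_prod_def atLeast0LessThan)
    also have "\<dots> = (if j = 0 then int m else if i = j then 0 else 1)"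
    proof (cases "j = 0")
      case True
      have "(\<Sum>l<?n. (if i = l then 0 else 1 :: int)) = (\<Sum>l<?n. 1 - (if i = l then 1 else 0))"
        by (intro sum.cong) auto
      also have "\<dots> = int m" using i by (simp add: sum_subtractf)
      finally show ?thesis using True by simp
    next
      case False
      have "(\<Sum>l<?n. (if i = l then 0 else 1) * (if l = j \<or> j = 0 then 1 else 0)) =
          (\<Sum>l<?n. if l = j then (if i = j then 0 else 1 :: int) else 0)"
        using False by (intro sum.cong) auto
      then show ?thesis using False j by simp
    qed
    finally have 1: "(?K * U) $$ (i, j) = (if j = 0 then int m else if i = j then 0 else 1)" .
    have "(U * T) $$ (i, j) = (\<Sum>l<?n. (if i = l \<or> l = 0 then 1 else 0) *
        (if l = 0 then (if j = 0 then int m else 1) else if l = j then - 1 else 0))"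
      using i j by (simp add: T_def U_def scalar_prod_def atLeast0LessThan)
    also have "\<dots> = (\<Sum>l<?n. (if l = 0 then (if j = 0 then int m else 1) else 0) +
        (if l = i then (if i \<noteq> 0 \<and> i = j then - 1 else 0) else 0))"
      by (intro sum.cong) auto
    also have "\<dots> = (if j = 0 then int m else if i = j then 0 else 1)"
      using i unfolding sum.distrib by simp
    finally show "(?K * U) $$ (i, j) = (U * T) $$ (i, j)" using 1 by simp
  qed (simp_all add: offdiag_ones_def U_def T_def)
  then have "det ?K * det U = det U * det T"
    using det_mult[OF c(1,2)] det_mult[OF c(2,3)] by metis
  then show ?thesis by (simp add: U T)
qed

text \<open>In the Leibniz expansion a permutation with a fixed point contributes 0 to both
  determinants; any other one contributes a signed monomial of degree \<open>n\<close>.\<close>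

lemma det_in_homogeneous_values:
  fixes A :: "'a::field mat"
  assumes "L_matrix L n A"
  shows "(det (offdiag_ones n), det A) \<in> homogeneous_values n L"
proof -
  have A: "A \<in> carrier_mat n n" and diag: "\<And>i. i < n \<Longrightarrow> A $$ (i, i) = 0"
    and off: "\<And>i j. i < n \<Longrightarrow> j < n \<Longrightarrow> i \<noteq> j \<Longrightarrow> A $$ (i, j) \<in> L"
    using assms unfolding L_matrix_def by auto
  have K: "offdiag_ones n \<in> carrier_mat n n" by (simp add: offdiag_ones_def)
  have summand: "((\<Prod>i = 0..<n. offdiag_ones n $$ (i, p i)), (\<Prod>i = 0..<n. A $$ (i, p i)))
      \<in> homogeneous_values n L" if p: "p permutes {0..<n}" for p
  proof (cases "\<exists>i<n. p i = i")
    case True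
    then obtain i where i: "i < n" "p i = i" by blast
    have "(\<Prod>i = 0..<n. offdiag_ones n $$ (i, p i)) = 0" "(\<Prod>i = 0..<n. A $$ (i, p i)) = 0"
      using i by (auto intro!: prod_zero bexI[of _ i] simp: diag offdiag_ones_def)
    then show ?thesis by (simp only: homogeneous_values_zero)
  next
    case False
    have pn: "p i < n" if "i < n" for i
      using p that permutes_in_image[OF p, of i] by simp
    have "(\<Prod>i = 0..<n. offdiag_ones n $$ (i, p i)) = (\<Prod>i = 0..<n. 1)"
      using False pn by (intro prod.cong) (auto simp: offdiag_ones_def)
    moreover have "(\<Prod>i = 0..<n. A $$ (i, p i)) = prod_list (map (\<lambda>i. A $$ (i, p i)) [0..<n])"
      using prod.distinct_set_conv_list[OF distinct_upt, of "\<lambda>i. A $$ (i, p i)" 0 n] by simp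
    moreover have "(1, prod_list (map (\<lambda>i. A $$ (i, p i)) [0..<n])) \<in> homogeneous_values n L"
      using False pn off by (intro monomial_in_homogeneous_values) force+
    ultimately show ?thesis by simp
  qed
  have "(signof p * (\<Prod>i = 0..<n. offdiag_ones n $$ (i, p i)), signof p * (\<Prod>i = 0..<n. A $$ (i, p i)))
      \<in> homogeneous_values n L" if "p permutes {0..<n}" for p
    using homogeneous_values_of_int_mult[OF summand[OF that], of "sign p"] by simp
  then show ?thesis
    unfolding det_def'[OF A] det_def'[OF K] by (intro homogeneous_values_sum) simp
qed

lemma homogeneous_values_of_corank_two:
  fixes L :: "'a::field set"
  assumes n: "n \<ge> r + 1" "n \<in> L_sizes (r - 1) L" and "r \<ge> 1" and "\<alpha> \<in> L"
  shows "\<exists>d. (1, 0) \<in> homogeneous_values d L"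
proof -
  obtain s where r: "r = Suc s" using \<open>r \<ge> 1\<close> by (cases r) auto
  \<comment> \<open>Applied to \<open>m = s\<close> and \<open>m = Suc s\<close>: both sizes
    \<open>Suc m\<close> exceed the rank bound \<open>s\<close>, so the determinants vanish.\<close>
  have vals: "((- 1) ^ m * int m, 0) \<in> homogeneous_values (Suc m) L"
    if "m \<ge> s" "Suc m \<le> n" for m
  proof -
    have "Suc m \<in> L_sizes s L" using n(2) L_sizes_downward[OF _ that(2)] r by simp
    then obtain A where A: "L_matrix L (Suc m) A" "vec_space.rank (Suc m) A \<le> s"
      unfolding L_sizes_def by blast
    then have c: "A \<in> carrier_mat (Suc m) (Suc m)" unfolding L_matrix_def by blast
    have "det A = 0"
    proof (rule ccontr)
      assume "det A \<noteq> 0"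
      from vec_space.low_rank_det_zero[OF c this] A(2) that(1) show False by simp
    qed
    then show ?thesis
      using det_in_homogeneous_values[OF A(1)] by (simp add: det_offdiag_ones)
  qed
  have 1: "((- 1) ^ Suc s * int (Suc s), 0) \<in> homogeneous_values (Suc (Suc s)) L"
    using vals[of "Suc s"] n r by simp
  have 2: "((- 1) ^ s * int s, 0) \<in> homogeneous_values (Suc (Suc s)) L"
    using homogeneous_values_mult[OF vals[of s] \<open>\<alpha> \<in> L\<close>] n r by simp
  \<comment> \<open>The multiples \<open>s + 1\<close> and \<open>s\<close> enter with opposite
    signs and leave a unit.\<close>
  have "((- 1) ^ Suc s, 0) \<in> homogeneous_values (Suc (Suc s)) L"
    using homogeneous_values_add[OF 1 2] by (simp add: algebra_simps)
  from homogeneous_values_of_int_mult[OF this, of "(- 1) ^ Suc s"]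
  show ?thesis by (auto simp: power_mult_distrib[symmetric])
qed

section \<open>Translation to polynomial mappings\<close>

lemma sum_keys_superset:
  assumes "finite X" "Poly_Mapping.keys m \<subseteq> X"
  shows "(\<Sum>i\<in>Poly_Mapping.keys m. Poly_Mapping.lookup m i) = (\<Sum>i\<in>X. Poly_Mapping.lookup m i)"
  using assms by (intro sum.mono_neutral_left) (auto simp: in_keys_iff)

lemma prod_keys_superset:
  assumes "finite X" "Poly_Mapping.keys m \<subseteq> X"
  shows "(\<Prod>i\<in>Poly_Mapping.keys m. x i ^ Poly_Mapping.lookup m i) =
    (\<Prod>i\<in>X. x i ^ Poly_Mapping.lookup m i :: 'a::comm_ring_1)"
  using assms by (intro prod.mono_neutral_left) (auto simp: in_keys_iff)

lemma eval_mpoly_superset: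
  assumes "finite K" "Poly_Mapping.keys P \<subseteq> K"
  shows "eval_mpoly P x = (\<Sum>m\<in>K. of_int (Poly_Mapping.lookup P m) *
     (\<Prod>i\<in>Poly_Mapping.keys m. x i ^ Poly_Mapping.lookup m i))"
  unfolding eval_mpoly_def using assms by (intro sum.mono_neutral_left) (auto simp: in_keys_iff)

lemma eval_mpoly_single:
  "eval_mpoly (Poly_Mapping.single m 1) x = (\<Prod>i\<in>Poly_Mapping.keys m. x i ^ Poly_Mapping.lookup m i)"
  by (simp add: eval_mpoly_def)

lemma eval_mpoly_diff: "eval_mpoly (P - Q) x = eval_mpoly P x - eval_mpoly Q x"
proof -
  let ?K = "Poly_Mapping.keys P \<union> Poly_Mapping.keys Q"
  have "finite ?K" "Poly_Mapping.keys (P - Q) \<subseteq> ?K" using keys_diff[of P Q] by auto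
  then show ?thesis
    by (simp add: eval_mpoly_superset[of ?K] lookup_minus left_diff_distrib sum_subtractf)
qed

text \<open>Each letter is charged to one chosen index with that value, whose exponent goes up by 1;
  \<open>x\<close> may take the same value at several indices.\<close>

lemma prod_list_as_monomial:
  fixes x :: "nat \<Rightarrow> 'a::comm_ring_1"
  assumes "set ws \<subseteq> x ` X" "finite X"
  shows "\<exists>m. Poly_Mapping.keys m \<subseteq> X \<and>
    (\<Sum>i\<in>Poly_Mapping.keys m. Poly_Mapping.lookup m i) = length ws \<and>
    (\<Prod>i\<in>Poly_Mapping.keys m. x i ^ Poly_Mapping.lookup m i) = prod_list ws"
  using assms(1)
proof (induction ws)
  case Nil
  then show ?case by (intro exI[of _ 0]) simp
next
  case (Cons w ws)
  then obtain j m where j: "j \<in> X" "w = x j" and m: "Poly_Mapping.keys m \<subseteq> X"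
    "(\<Sum>i\<in>Poly_Mapping.keys m. Poly_Mapping.lookup m i) = length ws"
    "(\<Prod>i\<in>Poly_Mapping.keys m. x i ^ Poly_Mapping.lookup m i) = prod_list ws"
    by auto
  define m' where "m' = m + Poly_Mapping.single j 1"
  have keys: "Poly_Mapping.keys m' \<subseteq> X"
    using keys_add[of m "Poly_Mapping.single j 1"] j m(1) unfolding m'_def by auto
  have lookup: "Poly_Mapping.lookup m' i = Poly_Mapping.lookup m i + (if i = j then 1 else 0)" for i
    by (simp add: m'_def lookup_add lookup_single when_def)
  have "(\<Sum>i\<in>X. Poly_Mapping.lookup m' i) = Suc (\<Sum>i\<in>X. Poly_Mapping.lookup m i)"
    using j(1) assms(2) by (simp add: lookup sum.distrib)
  moreover have "(\<Prod>i\<in>X. x i ^ Poly_Mapping.lookup m' i) =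
      (\<Prod>i\<in>X. x i ^ Poly_Mapping.lookup m i * (if i = j then x i else 1))"
    by (intro prod.cong) (simp_all add: lookup)
  then have "(\<Prod>i\<in>X. x i ^ Poly_Mapping.lookup m' i) =
      w * (\<Prod>i\<in>X. x i ^ Poly_Mapping.lookup m i)"
    using j assms(2) by (simp add: prod.distrib mult.commute)
  ultimately show ?case
    using m keys assms(2)
    by (intro exI[of _ m']) (simp add: sum_keys_superset[of X] prod_keys_superset[of X])
qed

lemma monomial_as_prod_list:
  fixes x :: "nat \<Rightarrow> 'a::comm_ring_1"
  assumes "finite S" "S \<subseteq> X"
  shows "\<exists>ws. set ws \<subseteq> x ` X \<and> length ws = (\<Sum>i\<in>S. e i) \<and> prod_list ws = (\<Prod>i\<in>S. x i ^ e i)"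
  using assms
proof (induction S rule: finite_induct)
  case empty
  then show ?case by (intro exI[of _ "[]"]) simp
next
  case (insert j S)
  then obtain ws where "set ws \<subseteq> x ` X" "length ws = (\<Sum>i\<in>S. e i)" "prod_list ws = (\<Prod>i\<in>S. x i ^ e i)"
    by auto
  with insert show ?case
    by (intro exI[of _ "replicate (e j) (x j) @ ws"]) (auto simp: prod_list_replicate)
qed

text \<open>This puts (b) into a form where induction over generation by monomials replaces
  computation with coefficients.\<close>

lemma homogeneous_values_eq_eval_mpoly:
  fixes x :: "nat \<Rightarrow> 'a::comm_ring_1"
  assumes "finite X"
  shows "(\<exists>d. (a, b) \<in> homogeneous_values d (x ` X)) \<longleftrightarrow>
    (\<exists>P. in_variables X P \<and> homogeneous P \<and> eval_mpoly P (\<lambda>_. 1 :: int) = a \<and> eval_mpoly P x = b)"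
proof
  \<comment> \<open>The degree is kept fixed, since \<open>homogeneous\<close> hides it and a
    difference of polynomials of different degrees need not be homogeneous.\<close>
  let ?Q = "\<lambda>d P. in_variables X P \<and>
     (\<forall>m\<in>Poly_Mapping.keys P. (\<Sum>i\<in>Poly_Mapping.keys m. Poly_Mapping.lookup m i) = d)"
  assume "\<exists>d. (a, b) \<in> homogeneous_values d (x ` X)"
  then obtain d where ab: "(a, b) \<in> homogeneous_values d (x ` X)" by blast
  have "\<exists>P. ?Q d P \<and> eval_mpoly P (\<lambda>_. 1 :: int) = fst p \<and> eval_mpoly P x = snd p"
    if "p \<in> homogeneous_values d (x ` X)" for p
    using that
  proof (induction rule: homogeneous_values_induct)
    case zero
    show ?case by (rule exI[of _ 0]) (simp add: in_variables_def eval_mpoly_def)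
  next
    case (monomial ws)
    obtain m where "Poly_Mapping.keys m \<subseteq> X"
      "(\<Sum>i\<in>Poly_Mapping.keys m. Poly_Mapping.lookup m i) = length ws"
      "(\<Prod>i\<in>Poly_Mapping.keys m. x i ^ Poly_Mapping.lookup m i) = prod_list ws"
      using prod_list_as_monomial[OF monomial(2) assms] by blast
    then show ?case
      using monomial(1)
      by (intro exI[of _ "Poly_Mapping.single m 1"]) (simp add: in_variables_def eval_mpoly_single)
  next
    case (diff a b a' b')
    then obtain P P' where
      "?Q d P \<and> eval_mpoly P (\<lambda>_. 1 :: int) = a \<and> eval_mpoly P x = b"
      "?Q d P' \<and> eval_mpoly P' (\<lambda>_. 1 :: int) = a' \<and> eval_mpoly P' x = b'"
      by blast
    moreover from this have "?Q d (P - P')"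
      using keys_diff[of P P'] unfolding in_variables_def by blast
    ultimately show ?case by (intro exI[of _ "P - P'"]) (simp add: eval_mpoly_diff)
  qed
  from this[OF ab] show "\<exists>P. in_variables X P \<and> homogeneous P \<and>
      eval_mpoly P (\<lambda>_. 1 :: int) = a \<and> eval_mpoly P x = b"
    unfolding homogeneous_def by auto
next
  assume "\<exists>P. in_variables X P \<and> homogeneous P \<and>
      eval_mpoly P (\<lambda>_. 1 :: int) = a \<and> eval_mpoly P x = b"
  then obtain P d where P: "in_variables X P" "eval_mpoly P (\<lambda>_. 1 :: int) = a" "eval_mpoly P x = b"
    and d: "\<forall>m\<in>Poly_Mapping.keys P. (\<Sum>i\<in>Poly_Mapping.keys m. Poly_Mapping.lookup m i) = d"
    unfolding homogeneous_def by blast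
  have "(\<Sum>m\<in>Poly_Mapping.keys P. of_int (Poly_Mapping.lookup P m) *
      (\<Prod>i\<in>Poly_Mapping.keys m. 1 ^ Poly_Mapping.lookup m i),
    \<Sum>m\<in>Poly_Mapping.keys P. of_int (Poly_Mapping.lookup P m) *
      (\<Prod>i\<in>Poly_Mapping.keys m. x i ^ Poly_Mapping.lookup m i)) \<in> homogeneous_values d (x ` X)"
  proof (rule homogeneous_values_sum)
    fix m assume m: "m \<in> Poly_Mapping.keys P"
    then have "Poly_Mapping.keys m \<subseteq> X" using P(1) unfolding in_variables_def by blast
    then obtain ws where "set ws \<subseteq> x ` X" "length ws = d"
      "prod_list ws = (\<Prod>i\<in>Poly_Mapping.keys m. x i ^ Poly_Mapping.lookup m i)"
      using monomial_as_prod_list[OF finite_keys] d m by metis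
    then have "(1, \<Prod>i\<in>Poly_Mapping.keys m. x i ^ Poly_Mapping.lookup m i) \<in> homogeneous_values d (x ` X)"
      using monomial_in_homogeneous_values by metis
    from homogeneous_values_of_int_mult[OF this, of "Poly_Mapping.lookup P m"]
    show "(of_int (Poly_Mapping.lookup P m) * (\<Prod>i\<in>Poly_Mapping.keys m. 1 ^ Poly_Mapping.lookup m i),
      of_int (Poly_Mapping.lookup P m) *
      (\<Prod>i\<in>Poly_Mapping.keys m. x i ^ Poly_Mapping.lookup m i)) \<in> homogeneous_values d (x ` X)"
      by simp
  qed
  then show "\<exists>d. (a, b) \<in> homogeneous_values d (x ` X)"
    using P(2,3) unfolding eval_mpoly_def by blast
qed

section \<open>From (b) to nonempty products of shifted elements\<close>

text \<open>With x = \<alpha> (1 + t), a monomial of degree \<open>d\<close> divided by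
  \<open>\<alpha> ^ d\<close> is a product of factors 1 + t, hence 1 plus an element of
  \<open>G\<close>. Thus a pair (a, b) of values has b / \<alpha>^d - a in \<open>G\<close>, and (1,
  0) yields -1.\<close>

lemma one_in_group_closure:
  fixes L :: "'a::field set"
  assumes "(1, 0) \<in> homogeneous_values d L" and "\<alpha> \<noteq> 0"
  shows "1 \<in> group_closure {prod_list ws | ws. ws \<noteq> [] \<and> set ws \<subseteq> (\<lambda>x. x / \<alpha> - 1) ` L}"
proof -
  define T where "T = (\<lambda>x. x / \<alpha> - 1) ` L"
  define G where "G = group_closure {prod_list ws | ws. ws \<noteq> [] \<and> set ws \<subseteq> T}"
  have diff: "a - b \<in> G" if "a \<in> G" "b \<in> G" for a b
    using that unfolding G_def by (rule group_closure.diff)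
  have add: "a + b \<in> G" if "a \<in> G" "b \<in> G" for a b
    using that unfolding G_def by (rule group_closure_add)
  have T: "t \<in> G" if "t \<in> T" for t
    unfolding G_def by (rule group_closure.base) (use that in \<open>auto intro!: exI[of _ "[t]"]\<close>)
  have mult: "t * y \<in> G" if "y \<in> G" "t \<in> T" for y t
    using that(1) unfolding G_def
  proof induction
    case (base y)
    then consider "y = 0" | ws where "ws \<noteq> []" "set ws \<subseteq> T" "y = prod_list ws" by auto
    then show ?case
    proof cases
      case 2
      then show ?thesis
        using \<open>t \<in> T\<close> by (intro group_closure.base) (auto intro!: exI[of _ "t # ws"])
    qed simp
  next
    case (diff y y')
    then show ?case by (simp add: right_diff_distrib group_closure.diff)
  qed
  have word: "prod_list ws / \<alpha> ^ length ws - 1 \<in> G" if "set ws \<subseteq> L" for ws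
    using that
  proof (induction ws)
    case Nil
    then show ?case by (simp add: G_def)
  next
    case (Cons x ws)
    let ?y = "prod_list ws / \<alpha> ^ length ws - 1" and ?t = "x / \<alpha> - 1"
    have "?t \<in> T" "?y \<in> G" using Cons by (auto simp: T_def)
    \<comment> \<open>This is the expansion of (1 + t) (1 + y) - 1.\<close>
    then have "?t * ?y + ?t + ?y \<in> G" using add mult T by metis
    also have "?t * ?y + ?t + ?y = prod_list (x # ws) / \<alpha> ^ length (x # ws) - 1"
      using \<open>\<alpha> \<noteq> 0\<close> by (simp add: field_simps)
    finally show ?case .
  qed
  have "snd p / \<alpha> ^ d - of_int (fst p) \<in> G" if "p \<in> homogeneous_values d L" for p
    using that
  proof (induction rule: homogeneous_values_induct)
    case zero
    then show ?case by (simp add: G_def)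
  next
    case (monomial ws)
    then show ?case using word[of ws] by simp
  next
    case (diff a b a' b')
    have "(b - b') / \<alpha> ^ d - of_int (a - a') =
        (b / \<alpha> ^ d - of_int a) - (b' / \<alpha> ^ d - of_int a')"
      by (simp add: diff_divide_distrib)
    then show ?case using diff \<open>\<And>a b. a \<in> G \<Longrightarrow> b \<in> G \<Longrightarrow> a - b \<in> G\<close> by metis
  qed
  from this[OF assms(1)] have "- 1 \<in> G" by simp
  then show ?thesis unfolding G_def T_def by simp
qed

section \<open>Fekete's argument\<close>

text \<open>In the shifted variable \<open>r + 2\<close> the hypothesis is plain superadditivity.
  The factor \<open>Suc m\<close> keeps the natural subtraction exact.\<close>

lemma mult_le_of_superadditive:
  fixes f :: "nat \<Rightarrow> nat"
  assumes add: "\<And>r s. f r + f s \<le> f (r + s + 2)"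
  shows "Suc m * f q \<le> f (Suc m * (q + 2) - 2)"
proof (induction m)
  case (Suc m)
  have eq: "Suc (Suc m) * (q + 2) - 2 = (Suc m * (q + 2) - 2) + q + 2" by simp
  show ?case unfolding eq using Suc add[of "Suc m * (q + 2) - 2" q] by simp
qed simp

text \<open>The quotients \<open>h r\<close> stay below their supremum, and for fixed
  \<open>q\<close> they are at least \<open>h q\<close> up to an error tending to 0. Extended reals
  cover an infinite supremum.\<close>

lemma superadditive_limit:
  fixes f :: "nat \<Rightarrow> nat"
  assumes add: "\<And>r s. f r + f s \<le> f (r + s + 2)" and "mono f"
  shows "(\<lambda>r. ereal (real (f r) / real r)) \<longlonglongrightarrow> (SUP r. ereal (real (f r) / real (r + 2)))"
    (is "_ \<longlonglongrightarrow> ?S")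
proof -
  define h where "h r = real (f r) / real (r + 2)" for r
  have lower: "h q - real (f q) / real (r + 2) \<le> h r" if "r \<ge> q" for q r
  proof -
    \<comment> \<open>The number of blocks of length \<open>q + 2\<close> that fit into
      \<open>r + 2\<close>.\<close>
    define m where "m = (r + 2) div (q + 2)"
    have "m \<ge> 1" using that by (simp add: m_def div_greater_zero_iff Suc_le_eq)
    have mr: "m * (q + 2) \<le> r + 2" unfolding m_def by (rule div_times_less_eq_dividend)
    have "m * f q \<le> f (m * (q + 2) - 2)"
    proof -
      obtain m' where m': "m = Suc m'" using \<open>m \<ge> 1\<close> by (cases m) auto
      show ?thesis unfolding m' by (rule mult_le_of_superadditive[of f, OF add])
    qed
    also have "\<dots> \<le> f r" using mr by (intro monoD[OF \<open>mono f\<close>]) simp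
    finally have 1: "real m * real (f q) \<le> real (f r)" by (metis of_nat_le_iff of_nat_mult)
    have "(r + 2) mod (q + 2) < q + 2" by simp
    then have "r + 2 < m * (q + 2) + (q + 2)"
      using div_mult_mod_eq[of "r + 2" "q + 2"] unfolding m_def by linarith
    then have "real (r + 2) < real (m * (q + 2) + (q + 2))" by (rule of_nat_less_iff[THEN iffD2])
    then have "real (r + 2) / real (q + 2) < real m + 1"
      by (simp add: divide_less_eq algebra_simps)
    then have "(real (r + 2) / real (q + 2) - 1) * real (f q) \<le> real m * real (f q)"
      by (intro mult_right_mono) auto
    with 1 have "(real (r + 2) / real (q + 2) - 1) * real (f q) \<le> real (f r)" by linarith
    then have "(real (r + 2) / real (q + 2) - 1) * real (f q) / real (r + 2) \<le> h r"
      unfolding h_def by (intro divide_right_mono) auto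
    also have "(real (r + 2) / real (q + 2) - 1) * real (f q) / real (r + 2) =
        h q - real (f q) / real (r + 2)"
      unfolding h_def by (simp add: field_simps)
    finally show ?thesis .
  qed
  have "(\<lambda>r. ereal (h r)) \<longlonglongrightarrow> ?S"
  proof (rule order_tendstoI)
    fix a assume "a < ?S"
    then obtain q where q: "a < ereal (h q)" unfolding h_def less_SUP_iff by blast
    have "(\<lambda>r. h q - real (f q) / real (r + 2)) \<longlonglongrightarrow> h q" by real_asymp
    then have "(\<lambda>r. ereal (h q - real (f q) / real (r + 2))) \<longlonglongrightarrow> ereal (h q)" by simp
    from order_tendstoD(1)[OF this q] eventually_ge_at_top[of q]
    show "\<forall>\<^sub>F r in sequentially. a < ereal (h r)"
    proof eventually_elim
      case (elim r)
      have "ereal (h q - real (f q) / real (r + 2)) \<le> ereal (h r)" using lower[OF elim(2)] by simp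
      with elim(1) show ?case by (rule less_le_trans)
    qed
  next
    fix a assume a: "?S < a"
    have "ereal (h r) \<le> ?S" for r unfolding h_def by (intro SUP_upper) simp
    then have "ereal (h r) < a" for r using a by (rule le_less_trans)
    then show "\<forall>\<^sub>F r in sequentially. ereal (h r) < a" by simp
  qed
  moreover have "(\<lambda>r. real (r + 2) / real r) \<longlonglongrightarrow> 1" by real_asymp
  then have "(\<lambda>r. ereal (real (r + 2) / real r)) \<longlonglongrightarrow> 1" by (simp add: one_ereal_def)
  ultimately have "(\<lambda>r. ereal (h r) * ereal (real (r + 2) / real r)) \<longlonglongrightarrow> ?S * 1"
    by (rule tendsto_mult_ereal) auto
  \<comment> \<open>At \<open>r = 0\<close> both sides are 0, because division by zero yields
    0.\<close>
  moreover have "ereal (h r) * ereal (real (r + 2) / real r) = ereal (real (f r) / real r)" for r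
    by (simp add: h_def)
  ultimately show ?thesis by (simp only: mult_1_right)
qed

section \<open>Corank three and the equivalences\<close>

lemma N_in_L_sizes: "finite L \<Longrightarrow> 0 \<notin> L \<Longrightarrow> N r L \<in> L_sizes r L"
  unfolding N_def by (metis Max_in empty_iff finite_L_sizes zero_in_L_sizes)

lemma le_N: "finite L \<Longrightarrow> 0 \<notin> L \<Longrightarrow> n \<in> L_sizes r L \<Longrightarrow> n \<le> N r L"
  unfolding N_def by (intro Max_ge finite_L_sizes)

text \<open>Scaled by \<alpha>, the weights y / \<alpha> - 1, their negatives and 0 become y -
  \<alpha>, \<alpha> - y and \<alpha> - \<alpha>, which are differences of elements of
  \<open>L\<close>.\<close>

lemma corank_three_of_homogeneous_values:
  fixes L :: "'a::field set"
  assumes "(1, 0) \<in> homogeneous_values d L" and "\<alpha> \<in> L" and "\<alpha> \<noteq> 0"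
  shows "\<exists>q. q + 3 \<in> L_sizes q L"
proof -
  define T where "T = (\<lambda>x. x / \<alpha> - 1) ` L"
  have "1 \<in> chain_sums T"
    unfolding T_def by (intro one_in_chain_sums one_in_group_closure[OF assms(1,3)])
  then obtain n :: nat and W :: "nat \<Rightarrow> nat \<Rightarrow> 'a" and x
    where "x 0 = 1" and diag: "\<And>u. W u u = 0"
    and W: "\<And>u v. W u v \<in> insert 0 (T \<union> uminus ` T)"
    and x: "\<And>u. u \<le> n \<Longrightarrow> (\<Sum>v\<le>n. W u v * x v) = x u"
    by (rule chain_sums_fixed_vector) blast
  have "\<exists>b c. b \<in> L \<and> c \<in> L \<and> b - c = \<alpha> * W u v" for u v
  proof -
    from W[of u v] consider "W u v = 0" | y where "y \<in> L" "W u v = y / \<alpha> - 1"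
      | y where "y \<in> L" "W u v = - (y / \<alpha> - 1)"
      unfolding T_def by auto
    then show ?thesis
    proof cases
      case 1
      then show ?thesis using \<open>\<alpha> \<in> L\<close> by (intro exI[of _ \<alpha>]) simp
    next
      case 2
      then show ?thesis using \<open>\<alpha> \<in> L\<close> \<open>\<alpha> \<noteq> 0\<close>
        by (intro exI[of _ y] exI[of _ \<alpha>]) (simp add: right_diff_distrib)
    next
      case 3
      then show ?thesis using \<open>\<alpha> \<in> L\<close> \<open>\<alpha> \<noteq> 0\<close>
        by (intro exI[of _ \<alpha>] exI[of _ y]) (simp add: right_diff_distrib)
    qed
  qed
  then obtain b c where bc: "\<And>u v. b u v \<in> L \<and> c u v \<in> L \<and> b u v - c u v = \<alpha> * W u v"
    by metis
  \<comment> \<open>On the diagonal the difference is 0 - \<alpha>, so \<open>b' - c'\<close> is the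
    matrix \<alpha> (W - I) and \<open>x\<close> lies in its kernel.\<close>
  define b' where "b' u v = (if u = v then 0 else b u v)" for u v
  define c' where "c' u v = (if u = v then \<alpha> else c u v)" for u v
  have "4 * card {..n} \<in> L_sizes (4 * card {..n} - 3) L"
  proof (rule L_sizes_of_difference[of _ 0 x b' _ c'])
    fix u assume u: "u \<in> {..n}"
    have "(\<Sum>v\<le>n. (b' u v - c' u v) * x v) =
        (\<Sum>v\<le>n. \<alpha> * (W u v * x v) - (if u = v then \<alpha> * x u else 0))"
      using bc diag by (intro sum.cong) (auto simp: b'_def c'_def)
    also have "\<dots> = 0" using x[of u] u by (simp add: sum_subtractf flip: sum_distrib_left)
    finally show "(\<Sum>v\<in>{..n}. (b' u v - c' u v) * x v) = 0" .
  qed (use \<open>x 0 = 1\<close> bc \<open>\<alpha> \<in> L\<close> in \<open>auto simp: b'_def c'_def\<close>)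
  then show ?thesis by (intro exI[of _ "4 * n + 1"]) (simp add: algebra_simps)
qed

theorem theorem2:
  fixes L :: "'a::field set" and \<alpha> :: "nat \<Rightarrow> 'a" and k :: nat
  assumes "k \<ge> 1"
    and "inj_on \<alpha> {1..k}"
    and "L = \<alpha> ` {1..k}"
    and "0 \<notin> L"
  shows "((\<exists>r\<ge>1. N (r - 1) L \<ge> r + 1) \<longleftrightarrow>
          (\<exists>P. in_variables {1..k} P \<and> homogeneous P \<and>
               eval_mpoly P (\<lambda>_. 1 :: int) = 1 \<and> eval_mpoly P \<alpha> = 0)) \<and>
         ((\<exists>P. in_variables {1..k} P \<and> homogeneous P \<and>
               eval_mpoly P (\<lambda>_. 1 :: int) = 1 \<and> eval_mpoly P \<alpha> = 0) \<longleftrightarrow>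
          (\<exists>c::real. c > 1 \<and> (\<exists>r0. \<forall>r\<ge>r0. real (N r L) \<ge> c * real r))) \<and>
         (\<exists>l::ereal. (\<lambda>r. ereal (real (N r L) / real r)) \<longlonglongrightarrow> l)"
    (is "(?a \<longleftrightarrow> ?b) \<and> (?b \<longleftrightarrow> ?c) \<and> ?lim")
proof -
  have L: "finite L" "0 \<notin> L" using assms by auto
  have \<alpha>1: "\<alpha> 1 \<in> L" "\<alpha> 1 \<noteq> 0" using assms by auto
  have b: "?b \<longleftrightarrow> (\<exists>d. (1, 0) \<in> homogeneous_values d L)"
    unfolding \<open>L = \<alpha> ` {1..k}\<close> using homogeneous_values_eq_eval_mpoly[of "{1..k}" 1 0 \<alpha>] by simp
  have "N r L + N s L \<le> N (r + s + 2) L" for r s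
    by (intro le_N L L_sizes_add[OF _ _ \<alpha>1(1)] N_in_L_sizes)
  moreover have "mono (\<lambda>r. N r L)"
    by (intro monoI le_N L) (rule L_sizes_mono[OF N_in_L_sizes[OF L]])
  ultimately have lim: "(\<lambda>r. ereal (real (N r L) / real r)) \<longlonglongrightarrow>
      (SUP r. ereal (real (N r L) / real (r + 2)))"
    by (rule superadditive_limit[of "\<lambda>r. N r L"])
  have ab: ?b if ?a
    using that homogeneous_values_of_corank_two[OF _ N_in_L_sizes[OF L] _ \<alpha>1(1)] unfolding b by blast
  have bc: ?c if b': ?b
  proof -
    obtain q where "q + 3 \<in> L_sizes q L"
      using b' corank_three_of_homogeneous_values[OF _ \<alpha>1] unfolding b by blast
    then have "N q L \<ge> q + 3" by (rule le_N[OF L])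
    \<comment> \<open>Gluing costs rank 2, so the denominator is \<open>q + 2\<close>; corank 3 is
      the least that lifts the quotient above 1.\<close>
    then have "real (q + 3) / real (q + 2) \<le> real (N q L) / real (q + 2)"
      by (intro divide_right_mono) auto
    moreover have "1 < real (q + 3) / real (q + 2)" by (simp add: field_simps)
    ultimately have "1 < real (N q L) / real (q + 2)" by linarith
    \<comment> \<open>A constant strictly below one term of the supremum is strictly below the
      limit, so the bound holds eventually.\<close>
    then obtain c where c: "1 < c" "c < real (N q L) / real (q + 2)" using dense by blast
    have "ereal c < ereal (real (N q L) / real (q + 2))" using c(2) by simp
    also have "\<dots> \<le> (SUP r. ereal (real (N r L) / real (r + 2)))" by (rule SUP_upper) simp
    finally have "ereal c < (SUP r. ereal (real (N r L) / real (r + 2)))" .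
    from order_tendstoD(1)[OF lim this] eventually_gt_at_top[of 0]
    have "\<forall>\<^sub>F r in sequentially. c * real r \<le> real (N r L)"
      by eventually_elim (simp add: less_divide_eq less_imp_le)
    with c(1) show ?c unfolding eventually_sequentially by blast
  qed
  have ca: ?a if c': ?c
  proof -
    from c' obtain c r0 where c: "c > 1" and r0: "\<And>r. r \<ge> r0 \<Longrightarrow> real (N r L) \<ge> c * real r"
      by blast
    \<comment> \<open>Large enough for (c - 1) r \<ge> 2, which gives corank at least 2; the index
      in (a) is then \<open>Suc r\<close>.\<close>
    define r where "r = max r0 (nat \<lceil>2 / (c - 1)\<rceil>)"
    have "2 / (c - 1) \<le> real r" unfolding r_def by linarith
    then have "2 \<le> real r * (c - 1)" using c by (simp add: divide_le_eq)
    then have "real r + 2 \<le> c * real r" by (simp add: algebra_simps)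
    also have "\<dots> \<le> real (N r L)" by (rule r0) (simp add: r_def)
    finally have "r + 2 \<le> N r L" by linarith
    then show ?a by (intro exI[of _ "Suc r"]) simp
  qed
  show ?thesis using ab bc ca lim by blast
qed

end
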